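(* Let $X$ be a Cayley graph (with respect to a finite generating set) of a finitely generated group with finite Assouad–Nagata dimension. Then there is a constant $C>0$ such that for every $n\ge 2$, every subgraph of $X$ with exactly $n$ vertices has Cheeger constant at most $C/\log(n)$.
   Context: For a finite graph $\Gamma$ with $n\ge 2$ vertices and $A\subseteq V(\Gamma)$, the vertex boundary $\partial A$ is the set of vertices of $V(\Gamma)\setminus A$ having a neighbour in $A$, and the (vertex) Cheeger constant is $h(\Gamma)=\min\{|\partial A|/|A| : \emptyset\neq A\subseteq V(\Gamma),\ |A|\le n/2\}$. A metric space $X$ has Assouad–Nagata dimension at most $m$ if there is a constant $C'>0$ such that for all $r>0$ one can partition $X$ into $m+1$ subsets $X_0,\dots,X_m$ and each $X_i$ into sets $X_{i,j}$ with $\mathrm{diam}(X_{i,j})\le C'r$ and $d(X_{i,j},X_{i,j'})>r$ whenever $j\ne j'$. It has finite Assouad–Nagata dimension if this holds for some $m\in\mathbb{N}$. A finitely generated group is given the word metric, i.e. the shortest path metric on the vertex set of its Cayley graph. *)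

theory Defs
  imports Complex_Main "HOL-Library.Extended_Real" "HOL-Library.Disjoint_Sets"
    "HOL-Algebra.Generated_Groups"
begin

section \<open>Simple graphs\<close>

type_synonym 'a ugraph = "'a set \<times> 'a set set"

abbreviation verts :: "'a ugraph \<Rightarrow> 'a set" where "verts \<equiv> fst"
abbreviation edges :: "'a ugraph \<Rightarrow> 'a set set" where "edges \<equiv> snd"

definition simple_graph :: "'a ugraph \<Rightarrow> bool" where
  "simple_graph \<Gamma> \<longleftrightarrow> (\<forall>e\<in>edges \<Gamma>. \<exists>u\<in>verts \<Gamma>. \<exists>v\<in>verts \<Gamma>. u \<noteq> v \<and> e = {u, v})"

text \<open>Subgraphs need not be induced.\<close>

definition subgraph :: "'a ugraph \<Rightarrow> 'a ugraph \<Rightarrow> bool" where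
  "subgraph \<Gamma> X \<longleftrightarrow> simple_graph \<Gamma> \<and> verts \<Gamma> \<subseteq> verts X \<and> edges \<Gamma> \<subseteq> edges X"

text \<open>The \<open>k\<close>-th relational power of adjacency relates the endpoints of walks with \<open>k\<close> edges.
  The value is meaningful only for vertices in the same connected component.\<close>

definition path_dist :: "'a ugraph \<Rightarrow> 'a \<Rightarrow> 'a \<Rightarrow> real" where
  "path_dist X u v = real (LEAST k. (u, v) \<in> {(x, y). {x, y} \<in> edges X} ^^ k)"

definition vertex_boundary :: "'a ugraph \<Rightarrow> 'a set \<Rightarrow> 'a set" where
  "vertex_boundary \<Gamma> A = {v \<in> verts \<Gamma> - A. \<exists>u\<in>A. {u, v} \<in> edges \<Gamma>}"

text \<open>For finite graphs with at least two vertices, the set under \<^const>\<open>Min\<close> is finite and nonempty.\<close>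

definition cheeger_constant :: "'a ugraph \<Rightarrow> real" where
  "cheeger_constant \<Gamma> =
     Min {real (card (vertex_boundary \<Gamma> A)) / real (card A) | A.
            A \<noteq> {} \<and> A \<subseteq> verts \<Gamma> \<and> real (card A) \<le> real (card (verts \<Gamma>)) / 2}"


section \<open>Cayley graphs\<close>

text \<open>Edges are unordered pairs, so it is not necessary to close \<open>S\<close> under inverses;
  the generator \<open>\<one>\<close>, if present, yields no edge.\<close>

definition cayley_graph :: "('a, 'b) monoid_scheme \<Rightarrow> 'a set \<Rightarrow> 'a ugraph" where
  "cayley_graph G S =
     (carrier G, {{g, g \<otimes>\<^bsub>G\<^esub> s} | g s. g \<in> carrier G \<and> s \<in> S \<and> g \<otimes>\<^bsub>G\<^esub> s \<noteq> g})"


section \<open>Assouad--Nagata dimension of a metric space \<open>(M, d)\<close>\<close>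

text \<open>Extended reals give unbounded sets diameter \<open>\<infinity>\<close>, where \<open>Sup\<close> on \<open>real\<close> is unspecified.\<close>

definition set_diam :: "('a \<Rightarrow> 'a \<Rightarrow> real) \<Rightarrow> 'a set \<Rightarrow> ereal" where
  "set_diam d A = (SUP x\<in>A. SUP y\<in>A. ereal (d x y))"

definition set_dist :: "('a \<Rightarrow> 'a \<Rightarrow> real) \<Rightarrow> 'a set \<Rightarrow> 'a set \<Rightarrow> ereal" where
  "set_dist d A B = (INF x\<in>A. INF y\<in>B. ereal (d x y))"

text \<open>The parts \<open>Y i\<close> may be empty; \<open>P i\<close> is the collection of the pieces of \<open>Y i\<close>,
  which are nonempty and pairwise disjoint.\<close>

definition AN_dim_le :: "'a set \<Rightarrow> ('a \<Rightarrow> 'a \<Rightarrow> real) \<Rightarrow> nat \<Rightarrow> bool" where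
  "AN_dim_le M d m \<longleftrightarrow>
     (\<exists>C'>0. \<forall>r>0. \<exists>(Y :: nat \<Rightarrow> 'a set) (P :: nat \<Rightarrow> 'a set set).
        (\<Union>i\<le>m. Y i) = M \<and> disjoint_family_on Y {..m} \<and>
        (\<forall>i\<le>m. partition_on (Y i) (P i) \<and>
           (\<forall>A\<in>P i. set_diam d A \<le> ereal (C' * r)) \<and>
           (\<forall>A\<in>P i. \<forall>B\<in>P i. A \<noteq> B \<longrightarrow> set_dist d A B > ereal r)))"

definition finite_AN_dim :: "'a set \<Rightarrow> ('a \<Rightarrow> 'a \<Rightarrow> real) \<Rightarrow> bool" where
  "finite_AN_dim M d \<longleftrightarrow> (\<exists>m. AN_dim_le M d m)"

end

theory Submission
  imports Defs
begin

text \<open>At scale \<open>r = 2 * K\<close>, one of the \<open>m + 1\<close> parts given by the Assouad--Nagata dimension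
  contains at least \<open>n / (m + 1)\<close> vertices of \<open>\<Gamma>\<close>. The \<open>K\<close>-neighbourhoods in \<open>\<Gamma>\<close> of its pieces are
  disjoint, and since balls in \<open>X\<close> grow at most exponentially, each has at most \<open>n / 2\<close> vertices when
  \<open>K\<close> is a small multiple of \<open>log n\<close>. If \<open>h\<close> is the Cheeger constant of \<open>\<Gamma>\<close>, every piece grows by a
  factor \<open>1 + h\<close> in each of the \<open>K\<close> steps, so \<open>(1 + h) ^ K * n / (m + 1) \<le> n\<close>, which forces
  \<open>h * K \<le> m\<close>.\<close>

section \<open>Walks of length at most \<open>n\<close>, encoded as powers of a reflexive
  closure\<close>

lemma relpow_reflcl_iff: "(x, y) \<in> (R\<^sup>=) ^^ n \<longleftrightarrow> (\<exists>k\<le>n. (x, y) \<in> R ^^ k)"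
proof (induction n arbitrary: y)
  case (Suc n)
  show ?case
  proof
    assume "(x, y) \<in> (R\<^sup>=) ^^ Suc n"
    then obtain z where "(x, z) \<in> (R\<^sup>=) ^^ n" "(z, y) \<in> R\<^sup>=" by auto
    then obtain k where "k \<le> n" "(x, z) \<in> R ^^ k" and "(z, y) \<in> R \<or> z = y"
      using Suc.IH by auto
    then show "\<exists>k\<le>Suc n. (x, y) \<in> R ^^ k"
      by (metis Suc_le_mono le_SucI relpow_Suc_I)
  next
    assume "\<exists>k\<le>Suc n. (x, y) \<in> R ^^ k"
    then obtain k where k: "k \<le> Suc n" "(x, y) \<in> R ^^ k" by blast
    show "(x, y) \<in> (R\<^sup>=) ^^ Suc n"
    proof (cases "k \<le> n")
      case True
      then have "(x, y) \<in> (R\<^sup>=) ^^ n" using Suc.IH k by blast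
      then show ?thesis by auto
    next
      case False
      then have "(x, y) \<in> R ^^ Suc n" using k by (metis le_Suc_eq)
      then obtain z where "(x, z) \<in> R ^^ n" "(z, y) \<in> R" by auto
      then show ?thesis using Suc.IH by auto
    qed
  qed
qed auto

text \<open>Exponential growth of balls: when \<open>R\<close> is the reflexive closure of
  adjacency, the image of a point under \<open>R ^^ n\<close> is its ball of radius
  \<open>n\<close>.\<close>

lemma card_relpow_Image_le:
  fixes R :: "('a \<times> 'a) set"
  assumes "\<And>x. finite (R `` {x}) \<and> card (R `` {x}) \<le> b"
  shows "finite ((R ^^ n) `` {x}) \<and> card ((R ^^ n) `` {x}) \<le> b ^ n"
proof (induction n)
  case (Suc n)
  let ?B = "(R ^^ n) `` {x}"
  have eq: "(R ^^ Suc n) `` {x} = (\<Union>y\<in>?B. R `` {y})" by auto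
  have "card (\<Union>y\<in>?B. R `` {y}) \<le> (\<Sum>y\<in>?B. card (R `` {y}))"
    by (rule card_UN_le) (use Suc.IH in blast)
  also have "\<dots> \<le> card ?B * b"
    using sum_bounded_above[of ?B "\<lambda>y. card (R `` {y})" b] assms by simp
  also have "\<dots> \<le> b ^ Suc n"
    using Suc.IH by (simp add: mult.commute)
  finally show ?case
    using eq assms Suc.IH by auto
qed simp

abbreviation adj :: "'a ugraph \<Rightarrow> ('a \<times> 'a) set" where
  "adj \<Gamma> \<equiv> {(x, y). {x, y} \<in> edges \<Gamma>}"

lemma sym_adj: "sym (adj \<Gamma>)"
  by (auto intro: symI simp: insert_commute)

lemma sym_relpow: "sym R \<Longrightarrow> sym (R ^^ n)"
  by (induction n) (auto simp: sym_conv_converse_eq converse_relcomp relpow_commute[symmetric])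

lemma path_dist_le:
  assumes "(u, v) \<in> ((adj X)\<^sup>=) ^^ n"
  shows "path_dist X u v \<le> real n"
proof -
  obtain k where "k \<le> n" "(u, v) \<in> adj X ^^ k"
    using assms unfolding relpow_reflcl_iff by blast
  then show ?thesis
    unfolding path_dist_def using Least_le[of "\<lambda>k. (u, v) \<in> adj X ^^ k" k] by simp
qed

text \<open>Reachability makes the \<open>LEAST\<close> in \<open>path_dist\<close> attained;
  without any walk its value is unspecified and a bound on it says nothing.\<close>

lemma path_dist_le_imp_relpow:
  assumes "(u, v) \<in> (adj X)\<^sup>*" and "path_dist X u v \<le> real n"
  shows "(u, v) \<in> ((adj X)\<^sup>=) ^^ n"
proof -
  obtain k where "(u, v) \<in> adj X ^^ k" using assms(1) by (auto simp: rtrancl_power)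
  then have "(u, v) \<in> adj X ^^ (LEAST k. (u, v) \<in> adj X ^^ k)" by (rule LeastI)
  with assms(2) show ?thesis
    unfolding path_dist_def relpow_reflcl_iff by auto
qed

section \<open>Degree and connectedness of Cayley graphs\<close>

lemma (in group) adj_cayley_graph_Image:
  assumes "S \<subseteq> carrier G"
  shows "adj (cayley_graph G S) `` {x} \<subseteq> (\<lambda>s. x \<otimes> s) ` S \<union> (\<lambda>s. x \<otimes> inv s) ` S"
proof
  fix y assume "y \<in> adj (cayley_graph G S) `` {x}"
  then obtain g s where gs: "{x, y} = {g, g \<otimes> s}" "g \<in> carrier G" "s \<in> S"
    by (auto simp: cayley_graph_def)
  have "g \<otimes> s \<otimes> inv s = g" using gs assms by (auto simp: m_assoc)
  \<comment> \<open>The unordered edge can be read from either end: \<open>x = g\<close> gives the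
    factor \<open>s\<close>, and \<open>x = g \<otimes> s\<close> gives
    \<open>inv s\<close>.\<close>
  with gs(1) have "y = x \<otimes> s \<or> y = x \<otimes> inv s" by (auto simp: doubleton_eq_iff)
  then show "y \<in> (\<lambda>s. x \<otimes> s) ` S \<union> (\<lambda>s. x \<otimes> inv s) ` S"
    using gs(3) by auto
qed

lemma (in group) card_adj_cayley_graph_le:
  assumes "finite S" and "S \<subseteq> carrier G"
  shows "finite (((adj (cayley_graph G S))\<^sup>=) `` {x}) \<and>
    card (((adj (cayley_graph G S))\<^sup>=) `` {x}) \<le> 2 * card S + 1"
proof -
  let ?T = "(\<lambda>s. x \<otimes> s) ` S \<union> (\<lambda>s. x \<otimes> inv s) ` S"
  have sub: "((adj (cayley_graph G S))\<^sup>=) `` {x} \<subseteq> insert x ?T"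
    using adj_cayley_graph_Image[OF assms(2), of x] by blast
  have "card (insert x ?T) \<le> Suc (card ?T)" by (rule card_insert_le_m1) auto
  also have "card ?T \<le> card S + card S"
    by (rule order.trans[OF card_Un_le]) (intro add_mono card_image_le assms)
  finally have "card (insert x ?T) \<le> 2 * card S + 1" by simp
  moreover have "finite (insert x ?T)" using assms(1) by simp
  ultimately show ?thesis
    using sub by (meson card_mono finite_subset order.trans)
qed

lemma (in group) cayley_graph_connected:
  assumes "S \<subseteq> carrier G" and "generate G S = carrier G"
    and x: "x \<in> carrier G" and y: "y \<in> carrier G"
  shows "(x, y) \<in> (adj (cayley_graph G S))\<^sup>*"
proof -
  let ?R = "adj (cayley_graph G S)"
  have step: "(g, g \<otimes> s) \<in> ?R\<^sup>*" if "g \<in> carrier G" "s \<in> S" for g s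
    using that by (cases "g \<otimes> s = g") (auto simp: cayley_graph_def intro!: r_into_rtrancl)
  \<comment> \<open>The base point \<open>g\<close> is quantified inside the induction because the
    second factor of a product is walked starting from \<open>g \<otimes> a\<close>.\<close>
  have "\<forall>g\<in>carrier G. (g, g \<otimes> a) \<in> ?R\<^sup>*" if "a \<in> generate G S" for a
    using that
  proof induction
    case (inv s)
    show ?case
    proof
      fix g assume g: "g \<in> carrier G"
      have s: "s \<in> carrier G" using inv assms by blast
      \<comment> \<open>A step by \<open>inv s\<close> is the walk from
        \<open>g \<otimes> inv s\<close> to \<open>g\<close> along the generator \<open>s\<close>,
        reversed by symmetry.\<close>
      have "(g \<otimes> inv s, g \<otimes> inv s \<otimes> s) \<in> ?R\<^sup>*" using g s inv by (intro step) auto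
      then have "(g \<otimes> inv s, g) \<in> ?R\<^sup>*" using g s by (simp add: m_assoc)
      then show "(g, g \<otimes> inv s) \<in> ?R\<^sup>*"
        by (rule symD[OF sym_rtrancl[OF sym_adj]])
    qed
  next
    case (eng a b)
    then have ab: "a \<in> carrier G" "b \<in> carrier G" using assms by auto
    show ?case
    proof
      fix g assume g: "g \<in> carrier G"
      have "(g, g \<otimes> a) \<in> ?R\<^sup>*" "(g \<otimes> a, g \<otimes> a \<otimes> b) \<in> ?R\<^sup>*"
        using eng.IH g ab by auto
      then show "(g, g \<otimes> (a \<otimes> b)) \<in> ?R\<^sup>*"
        using g ab by (simp add: m_assoc)
    qed
  qed (use step in auto)
  from this[of "inv x \<otimes> y"] have "(x, x \<otimes> (inv x \<otimes> y)) \<in> ?R\<^sup>*" using x y assms(2) by auto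
  then show ?thesis using x y by (simp add: m_assoc[symmetric])
qed

section \<open>The Cheeger constant and growth of neighbourhoods in a finite graph\<close>

context
  fixes \<Gamma> :: "'a ugraph"
  assumes simple: "simple_graph \<Gamma>" and fin: "finite (verts \<Gamma>)" and two: "2 \<le> card (verts \<Gamma>)"
begin

lemma cheeger_constant_le:
  assumes "A \<noteq> {}" "A \<subseteq> verts \<Gamma>" "real (card A) \<le> real (card (verts \<Gamma>)) / 2"
  shows "cheeger_constant \<Gamma> \<le> real (card (vertex_boundary \<Gamma> A)) / real (card A)"
  unfolding cheeger_constant_def
  by (rule Min_le) (use assms fin in auto)

text \<open>Singletons compete in the minimum as soon as there are two vertices, so
  \<open>Min\<close> ranges over a nonempty set.\<close>

lemma singleton_admissible: "real (card {v}) \<le> real (card (verts \<Gamma>)) / 2"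
  using two by simp

lemma cheeger_constant_nonneg: "0 \<le> cheeger_constant \<Gamma>"
proof -
  obtain v where v: "v \<in> verts \<Gamma>" using two by fastforce
  show ?thesis
    unfolding cheeger_constant_def
  proof (rule Min.boundedI)
    show "{real (card (vertex_boundary \<Gamma> A)) / real (card A) |A.
        A \<noteq> {} \<and> A \<subseteq> verts \<Gamma> \<and> real (card A) \<le> real (card (verts \<Gamma>)) / 2} \<noteq> {}"
      using v singleton_admissible[of v] by blast
  qed (use fin in auto)
qed

text \<open>A crude bound from a singleton, enough for the graphs that are too small for the scale
  argument.\<close>

lemma cheeger_constant_le_card: "cheeger_constant \<Gamma> \<le> real (card (verts \<Gamma>))"
proof -
  obtain v where v: "v \<in> verts \<Gamma>" using two by fastforce
  have "cheeger_constant \<Gamma> \<le> real (card (vertex_boundary \<Gamma> {v})) / real (card {v})"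
    by (rule cheeger_constant_le) (use v singleton_admissible[of v] in auto)
  also have "\<dots> \<le> real (card (verts \<Gamma>))"
    using fin by (auto simp: vertex_boundary_def intro!: card_mono)
  finally show ?thesis .
qed

text \<open>Simplicity keeps the endpoints of edges inside \<open>verts \<Gamma>\<close>, so every
  neighbour outside \<open>A\<close> is counted in the boundary.\<close>

lemma adj_reflcl_Image: "A \<subseteq> verts \<Gamma> \<Longrightarrow> ((adj \<Gamma>)\<^sup>=) `` A = A \<union> vertex_boundary \<Gamma> A"
  using simple by (fastforce simp: vertex_boundary_def simple_graph_def doubleton_eq_iff)

lemma relpow_adj_Image_subset: "A \<subseteq> verts \<Gamma> \<Longrightarrow> (((adj \<Gamma>)\<^sup>=) ^^ k) `` A \<subseteq> verts \<Gamma>"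
proof (induction k)
  case (Suc k)
  have "(((adj \<Gamma>)\<^sup>=) ^^ Suc k) `` A = ((adj \<Gamma>)\<^sup>=) `` ((((adj \<Gamma>)\<^sup>=) ^^ k) `` A)" by auto
  then show ?case
    using adj_reflcl_Image[OF Suc.IH[OF Suc.prems]] Suc by (auto simp: vertex_boundary_def)
qed simp

text \<open>Each step adds the vertex boundary of the current neighbourhood, which is at least
  \<open>cheeger_constant \<Gamma>\<close> times its size as long as that size is at most half.
  Neighbourhoods increase with \<open>k\<close>, so bounding the last one bounds them all.\<close>

lemma cheeger_growth:
  assumes "A \<subseteq> verts \<Gamma>" "A \<noteq> {}"
    and "real (card ((((adj \<Gamma>)\<^sup>=) ^^ k) `` A)) \<le> real (card (verts \<Gamma>)) / 2"
  shows "(1 + cheeger_constant \<Gamma>) ^ k * real (card A) \<le> real (card ((((adj \<Gamma>)\<^sup>=) ^^ k) `` A))"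
  using assms(3)
proof (induction k)
  case (Suc k)
  let ?h = "cheeger_constant \<Gamma>"
  let ?T = "(((adj \<Gamma>)\<^sup>=) ^^ k) `` A"
  have T: "?T \<subseteq> verts \<Gamma>" by (rule relpow_adj_Image_subset[OF assms(1)])
  have finT: "finite ?T" using T fin finite_subset by blast
  have "(((adj \<Gamma>)\<^sup>=) ^^ Suc k) `` A = ((adj \<Gamma>)\<^sup>=) `` ?T" by auto
  then have eq: "(((adj \<Gamma>)\<^sup>=) ^^ Suc k) `` A = ?T \<union> vertex_boundary \<Gamma> ?T"
    using adj_reflcl_Image[OF T] by simp
  have card_eq: "card ((((adj \<Gamma>)\<^sup>=) ^^ Suc k) `` A) = card ?T + card (vertex_boundary \<Gamma> ?T)"
    unfolding eq by (rule card_Un_disjoint) (use finT fin in \<open>auto simp: vertex_boundary_def\<close>)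
  have small: "real (card ?T) \<le> real (card (verts \<Gamma>)) / 2"
    using Suc.prems card_eq by linarith
  have "(a, a) \<in> ((adj \<Gamma>)\<^sup>=) ^^ k" for a
    unfolding relpow_reflcl_iff by (auto intro: exI[of _ 0])
  then have ne: "?T \<noteq> {}" using assms(2) by blast
  then have pos: "real (card ?T) > 0" using finT by (simp add: card_gt_0_iff)
  have "?h * real (card ?T) \<le> real (card (vertex_boundary \<Gamma> ?T))"
    using cheeger_constant_le[OF ne T small] pos by (simp add: pos_le_divide_eq)
  moreover have "(1 + ?h) * ((1 + ?h) ^ k * real (card A)) \<le> (1 + ?h) * real (card ?T)"
    using Suc.IH[OF small] cheeger_constant_nonneg by (intro mult_left_mono) auto
  ultimately show ?case
    unfolding card_eq by (simp add: algebra_simps)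
qed simp

text \<open>The growth estimates of the members add up: the sets in \<open>F\<close> are disjoint,
  and their neighbourhoods are disjoint subsets of \<open>verts \<Gamma>\<close>.\<close>

lemma cheeger_growth_disjoint_family:
  assumes F: "\<And>A. A \<in> F \<Longrightarrow> A \<subseteq> verts \<Gamma> \<and> A \<noteq> {}" and disj: "disjoint F"
    and small: "\<And>A. A \<in> F \<Longrightarrow>
      real (card ((((adj \<Gamma>)\<^sup>=) ^^ k) `` A)) \<le> real (card (verts \<Gamma>)) / 2"
    and far: "\<And>A B. A \<in> F \<Longrightarrow> B \<in> F \<Longrightarrow> A \<noteq> B \<Longrightarrow>
      (((adj \<Gamma>)\<^sup>=) ^^ k) `` A \<inter> (((adj \<Gamma>)\<^sup>=) ^^ k) `` B = {}"
  shows "(1 + cheeger_constant \<Gamma>) ^ k * real (card (\<Union>F)) \<le> real (card (verts \<Gamma>))"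
proof -
  let ?N = "\<lambda>A. (((adj \<Gamma>)\<^sup>=) ^^ k) `` A"
  have finF: "finite F"
    by (rule finite_subset[of _ "Pow (verts \<Gamma>)"]) (use F fin in auto)
  have finA: "finite A" if "A \<in> F" for A
    using F[OF that] fin finite_subset by blast
  have N: "?N A \<subseteq> verts \<Gamma>" if "A \<in> F" for A
    using relpow_adj_Image_subset F[OF that] by blast
  have "card (\<Union>F) = (\<Sum>A\<in>F. card A)"
    by (rule card_Union_disjoint) (use disj finA in \<open>auto simp: disjoint_def pairwise_def disjnt_def\<close>)
  then have "(1 + cheeger_constant \<Gamma>) ^ k * real (card (\<Union>F))
      = (\<Sum>A\<in>F. (1 + cheeger_constant \<Gamma>) ^ k * real (card A))"
    by (simp add: sum_distrib_left)
  also have "\<dots> \<le> (\<Sum>A\<in>F. real (card (?N A)))"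
    by (intro sum_mono cheeger_growth small) (use F in auto)
  also have "\<dots> = real (card (\<Union>A\<in>F. ?N A))"
    using finF far N finite_subset[OF N fin] by (subst card_UN_disjoint) auto
  also have "\<dots> \<le> real (card (verts \<Gamma>))"
    using N fin by (intro of_nat_mono card_mono) auto
  finally show ?thesis .
qed

end

section \<open>From a cover at one scale to a bound on the Cheeger constant\<close>

lemma exists_large_part:
  assumes "finite V" and "V \<subseteq> (\<Union>i\<le>m. Y i)"
  obtains i where "i \<le> m" "card V \<le> (m + 1) * card (V \<inter> Y i)"
proof (rule ccontr)
  assume neg: "\<not> thesis"
  have "V = (\<Union>i\<le>m. V \<inter> Y i)" using assms(2) by auto
  then have "card V \<le> (\<Sum>i\<le>m. card (V \<inter> Y i))"
    using card_UN_le[of "{..m}" "\<lambda>i. V \<inter> Y i"] by simp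
  then have "(m + 1) * card V \<le> (\<Sum>i\<le>m. (m + 1) * card (V \<inter> Y i))"
    by (metis mult_le_mono2 sum_distrib_left)
  also have "\<dots> < (\<Sum>i\<le>m. card V)"
    by (rule sum_strict_mono) (use neg that in \<open>auto simp: not_le[symmetric]\<close>)
  finally show False by simp
qed

text \<open>The estimate at the single scale \<open>2 * K\<close>. A piece has diameter at most
  \<open>C' * 2 * K\<close>, hence at most \<open>c * K\<close>, so its
  \<open>K\<close>-neighbourhood lies in a ball of radius \<open>c * K + K\<close>;
  \<open>size\<close> makes that ball at most half of \<open>\<Gamma>\<close>.\<close>

lemma cheeger_constant_AN_bound:
  fixes X :: "'a ugraph" and C' :: real
  assumes sub: "subgraph \<Gamma> X" and two: "2 \<le> card (verts \<Gamma>)"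
    and conn: "\<And>x y. x \<in> verts X \<Longrightarrow> y \<in> verts X \<Longrightarrow> (x, y) \<in> (adj X)\<^sup>*"
    and deg: "\<And>x. finite (((adj X)\<^sup>=) `` {x}) \<and> card (((adj X)\<^sup>=) `` {x}) \<le> b"
    and cover: "(\<Union>i\<le>m. Y i) = verts X"
    and part: "\<And>i. i \<le> m \<Longrightarrow> partition_on (Y i) (P i)"
    and diam: "\<And>i A. i \<le> m \<Longrightarrow> A \<in> P i \<Longrightarrow> set_diam (path_dist X) A \<le> ereal (C' * real (2 * K))"
    and sep: "\<And>i A B. i \<le> m \<Longrightarrow> A \<in> P i \<Longrightarrow> B \<in> P i \<Longrightarrow> A \<noteq> B \<Longrightarrow>
      set_dist (path_dist X) A B > ereal (real (2 * K))"
    and C': "2 * C' \<le> real c"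
    and size: "2 * b ^ (c * K + K) \<le> card (verts \<Gamma>)"
  shows "cheeger_constant \<Gamma> * real K \<le> real m"
proof -
  let ?V = "verts \<Gamma>" and ?h = "cheeger_constant \<Gamma>"
  let ?E = "(adj \<Gamma>)\<^sup>=" and ?R = "(adj X)\<^sup>="
  have simple: "simple_graph \<Gamma>" and VX: "?V \<subseteq> verts X" and EX: "edges \<Gamma> \<subseteq> edges X"
    using sub by (auto simp: subgraph_def)
  have fin: "finite ?V" using two card.infinite by fastforce
  \<comment> \<open>Walks in \<open>\<Gamma>\<close> are walks in \<open>X\<close>, so distances in
    \<open>X\<close> control neighbourhoods taken in \<open>\<Gamma>\<close>.\<close>
  have ER: "?E ^^ k \<subseteq> ?R ^^ k" for k
    using EX by (induction k) (auto intro!: relcomp_mono)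
  have symR: "sym (?R ^^ k)" for k
    by (intro sym_relpow sym_Un sym_adj sym_Id)
  obtain i where i: "i \<le> m" and large: "card ?V \<le> (m + 1) * card (?V \<inter> Y i)"
    using exists_large_part[OF fin] VX cover by metis
  have Y: "\<Union>(P i) = Y i" and Pdisj: "disjoint (P i)"
    using part[OF i] by (auto simp: partition_on_def)
  have PX: "A \<subseteq> verts X" if "A \<in> P i" for A
    using that Y cover i by blast
  \<comment> \<open>The traces on \<open>\<Gamma>\<close> of the pieces of the large part; empty
    traces are dropped since growth needs nonempty sets.\<close>
  define F where "F = (\<lambda>A. A \<inter> ?V) ` P i - {{}}"
  have UF: "\<Union>F = ?V \<inter> Y i" unfolding F_def Y[symmetric] by blast
  have "(1 + ?h) ^ K * real (card (\<Union>F)) \<le> real (card ?V)"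
  proof (rule cheeger_growth_disjoint_family[OF simple fin two])
    show "disjoint F"
      using Pdisj by (fastforce simp: F_def disjoint_def)
  next
    fix A assume "A \<in> F"
    then obtain A' where A': "A' \<in> P i" "A = A' \<inter> ?V" "A \<noteq> {}" by (auto simp: F_def)
    then obtain p where p: "p \<in> A" by blast
    have "(?E ^^ K) `` A \<subseteq> (?R ^^ (c * K + K)) `` {p}"
    proof
      fix y assume "y \<in> (?E ^^ K) `` A"
      then obtain q where q: "q \<in> A" "(q, y) \<in> ?R ^^ K" using ER by blast
      have "ereal (path_dist X p q) \<le> set_diam (path_dist X) A'"
        unfolding set_diam_def using p q A' by (intro SUP_upper2[of p] SUP_upper) auto
      also have "\<dots> \<le> ereal (C' * real (2 * K))" using diam i A' by blast
      finally have "path_dist X p q \<le> (2 * C') * real K" by simp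
      also have "\<dots> \<le> real (c * K)" using C' by (simp add: mult_right_mono)
      finally have "path_dist X p q \<le> real (c * K)" .
      then have "(p, q) \<in> ?R ^^ (c * K)"
        using p q A' PX by (intro path_dist_le_imp_relpow conn) auto
      then show "y \<in> (?R ^^ (c * K + K)) `` {p}"
        using q by (auto simp: relpow_add)
    qed
    then have "card ((?E ^^ K) `` A) \<le> b ^ (c * K + K)"
      using card_relpow_Image_le[of ?R b, OF deg] by (meson card_mono order.trans)
    then have "2 * card ((?E ^^ K) `` A) \<le> card ?V" using size by linarith
    then show "real (card ((?E ^^ K) `` A)) \<le> real (card ?V) / 2" by linarith
  next
    fix A B assume "A \<in> F" "B \<in> F" and "A \<noteq> B"
    then obtain A' B' where A': "A' \<in> P i" "A = A' \<inter> ?V" and B': "B' \<in> P i" "B = B' \<inter> ?V"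
      and "A' \<noteq> B'" by (auto simp: F_def)
    show "(?E ^^ K) `` A \<inter> (?E ^^ K) `` B = {}"
    proof (rule ccontr)
      assume "(?E ^^ K) `` A \<inter> (?E ^^ K) `` B \<noteq> {}"
      then obtain y p q where p: "p \<in> A" "(p, y) \<in> ?R ^^ K" and q: "q \<in> B" "(q, y) \<in> ?R ^^ K"
        using ER by blast
      have "(y, q) \<in> ?R ^^ K" using q symR by (meson symD)
      \<comment> \<open>Two walks of length at most \<open>K\<close> meeting at \<open>y\<close>
        join to one of length at most \<open>2 * K\<close>, against the strict separation of the
        pieces.\<close>
      then have "(p, q) \<in> ?R ^^ (2 * K)" using p by (auto simp: mult_2 relpow_add)
      then have "path_dist X p q \<le> real (2 * K)" by (rule path_dist_le)
      moreover have "set_dist (path_dist X) A' B' \<le> ereal (path_dist X p q)"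
        unfolding set_dist_def using p q A' B' by (intro INF_lower2[of p] INF_lower) auto
      ultimately have "set_dist (path_dist X) A' B' \<le> ereal (real (2 * K))"
        by (meson ereal_less_eq(3) order.trans)
      then show False using sep[OF i A'(1) B'(1) \<open>A' \<noteq> B'\<close>] by simp
    qed
  qed (auto simp: F_def)
  then have grow: "(1 + ?h) ^ K * real (card (?V \<inter> Y i)) \<le> real (card ?V)" by (simp only: UF)
  also have "\<dots> \<le> (real m + 1) * real (card (?V \<inter> Y i))"
    using of_nat_mono[OF large, where 'a = real] by (simp add: algebra_simps)
  finally have "(1 + ?h) ^ K * real (card (?V \<inter> Y i)) \<le> (real m + 1) * real (card (?V \<inter> Y i))" .
  moreover have "card (?V \<inter> Y i) > 0" using large two by (intro Nat.gr0I) auto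
  ultimately have "(1 + ?h) ^ K \<le> real m + 1" by simp
  \<comment> \<open>Bernoulli turns the exponential inequality into the linear bound on
    \<open>?h * real K\<close>.\<close>
  moreover have "1 + real K * ?h \<le> (1 + ?h) ^ K"
    using cheeger_constant_nonneg[OF simple fin two] by (intro Bernoulli_inequality) simp
  ultimately show ?thesis by (simp add: mult.commute)
qed

section \<open>Choice of the scale and of the constant\<close>

theorem mainTheorem7:
  fixes G :: "('a, 'b) monoid_scheme" and S :: "'a set" and X :: "'a ugraph"
  assumes "group G"
    and "finite S" and "S \<subseteq> carrier G" and "generate G S = carrier G"
    and "X = cayley_graph G S"
    and "finite_AN_dim (verts X) (path_dist X)"
  shows "\<exists>C>0. \<forall>n\<ge>2. \<forall>\<Gamma>. subgraph \<Gamma> X \<and> card (verts \<Gamma>) = n \<longrightarrow>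
           cheeger_constant \<Gamma> \<le> C / ln (real n)"
proof -
  interpret group G by fact
  have vX: "verts X = carrier G" using assms(5) by (simp add: cayley_graph_def)
  obtain m C' where "C' > 0" and AN: "\<And>r. r > 0 \<Longrightarrow> \<exists>(Y :: nat \<Rightarrow> 'a set) P.
        (\<Union>i\<le>m. Y i) = verts X \<and> disjoint_family_on Y {..m} \<and>
        (\<forall>i\<le>m. partition_on (Y i) (P i) \<and>
           (\<forall>A\<in>P i. set_diam (path_dist X) A \<le> ereal (C' * r)) \<and>
           (\<forall>A\<in>P i. \<forall>B\<in>P i. A \<noteq> B \<longrightarrow> set_dist (path_dist X) A B > ereal r))"
    using assms(6) unfolding finite_AN_dim_def AN_dim_le_def by blast
  obtain c :: nat where c: "2 * C' \<le> real c" using real_arch_simple by blast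
  \<comment> \<open>Balls of radius one have at most \<open>2 * card S + 1\<close> points; one more
    ensures \<open>2 \<le> b\<close> even for empty \<open>S\<close>, so that
    \<open>ln (real B)\<close> is positive.\<close>
  define b where "b = 2 * card S + 2"
  \<comment> \<open>Chosen so that \<open>B ^ K\<close> is the bound \<open>b ^ (c * K + K)\<close>
    on the neighbourhoods.\<close>
  define B where "B = b ^ (c + 1)"
  have B2: "2 \<le> B"
    using self_le_power[of b "c + 1"] by (auto simp: B_def b_def)
  have conn: "(x, y) \<in> (adj X)\<^sup>*" if "x \<in> verts X" "y \<in> verts X" for x y
    using cayley_graph_connected[OF assms(3,4)] that vX assms(5) by simp
  have deg: "finite (((adj X)\<^sup>=) `` {x}) \<and> card (((adj X)\<^sup>=) `` {x}) \<le> b" for x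
    using card_adj_cayley_graph_le[OF assms(2,3), of x] assms(5) by (auto simp: b_def)
  \<comment> \<open>The first summand serves \<open>n < 2 * B\<close>, the second all larger
    \<open>n\<close>.\<close>
  define C where "C = 2 * real B * ln (2 * real B) + 3 * real m * ln (real B)"
  have pos: "2 * real B * ln (2 * real B) > 0" "ln (real B) > 0"
    using B2 by (auto intro!: mult_pos_pos ln_gt_zero)
  have "cheeger_constant \<Gamma> \<le> C / ln (real n)"
    if n: "2 \<le> n" and \<Gamma>: "subgraph \<Gamma> X" "card (verts \<Gamma>) = n" for n \<Gamma>
  proof -
    have two: "2 \<le> card (verts \<Gamma>)" and fin: "finite (verts \<Gamma>)" and simple: "simple_graph \<Gamma>"
      using n \<Gamma> card.infinite by (fastforce simp: subgraph_def)+
    have lnn: "ln (real n) > 0" using n by simp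
    have "cheeger_constant \<Gamma> * ln (real n) \<le> C"
    proof (cases "n < 2 * B")
      case True
      have "cheeger_constant \<Gamma> * ln (real n) \<le> (2 * real B) * ln (2 * real B)"
        using cheeger_constant_le_card[OF simple fin two] cheeger_constant_nonneg[OF simple fin two]
          True \<Gamma> n lnn by (intro mult_mono) auto
      then show ?thesis using pos by (simp add: C_def add_increasing2)
    next
      case False
      have "1 \<le> n div 2" using n by linarith
      \<comment> \<open>\<open>K\<close> is the integer part of the base-\<open>B\<close> logarithm
        of \<open>n div 2\<close>: the largest scale for which the size hypothesis holds.\<close>
      then obtain K where K: "B ^ K \<le> n div 2" "n div 2 < B ^ (K + 1)"
        using ex_power_ivl1[of B "n div 2"] B2 by auto
      have K1: "1 \<le> K"
      proof (rule ccontr)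
        assume "\<not> 1 \<le> K"
        then have "K = 0" by simp
        then show False using K False by simp
      qed
      have "real (2 * K) > 0" using K1 by simp
      from AN[OF this] obtain Y P where YP: "(\<Union>i\<le>m. Y i) = verts X"
        "\<forall>i\<le>m. partition_on (Y i) (P i) \<and>
           (\<forall>A\<in>P i. set_diam (path_dist X) A \<le> ereal (C' * real (2 * K))) \<and>
           (\<forall>A\<in>P i. \<forall>B\<in>P i. A \<noteq> B \<longrightarrow> set_dist (path_dist X) A B > ereal (real (2 * K)))"
        by blast
      have "B ^ K = b ^ (c * K + K)"
        by (simp add: B_def power_mult[symmetric] power_add[symmetric] algebra_simps del: power_Suc)
      then have size: "2 * b ^ (c * K + K) \<le> card (verts \<Gamma>)" using K \<Gamma> by linarith
      have hK: "cheeger_constant \<Gamma> * real K \<le> real m"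
        by (rule cheeger_constant_AN_bound[OF \<Gamma>(1) two conn deg YP(1) _ _ _ c size])
          (use YP(2) in blast)+
      \<comment> \<open>Maximality of \<open>K\<close> gives the converse comparison
        \<open>ln n \<le> 3 * K * ln B\<close>, where \<open>1 \<le> K\<close> absorbs the additive
        2 in the exponent. The bound in terms of \<open>K\<close> thus becomes one in terms of
        \<open>ln n\<close>.\<close>
      have "n < 2 * B ^ (K + 1)" using K by linarith
      also have "\<dots> \<le> B * B ^ (K + 1)" using B2 by simp
      also have "\<dots> = B ^ (K + 2)" by simp
      also have "\<dots> \<le> B ^ (3 * K)" using B2 K1 by (intro power_increasing) auto
      finally have "real n \<le> real (B ^ (3 * K))" by simp
      then have "ln (real n) \<le> ln (real B ^ (3 * K))" using n by (intro ln_mono) auto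
      also have "\<dots> = 3 * real K * ln (real B)" using B2 by (simp add: ln_realpow)
      finally have "cheeger_constant \<Gamma> * ln (real n) \<le> cheeger_constant \<Gamma> * (3 * real K * ln (real B))"
        using cheeger_constant_nonneg[OF simple fin two] by (rule mult_left_mono)
      also have "\<dots> = 3 * ln (real B) * (cheeger_constant \<Gamma> * real K)" by simp
      also have "\<dots> \<le> 3 * ln (real B) * real m" using hK pos by (intro mult_left_mono) auto
      finally show ?thesis using pos by (simp add: C_def mult_ac)
    qed
    then show ?thesis using lnn by (simp add: pos_le_divide_eq)
  qed
  moreover have "C > 0" using pos by (auto simp: C_def intro!: add_pos_nonneg)
  ultimately show ?thesis by blast
qed

end
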